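(* Let $P$ be an abelian left-cancellative semigroup with identity, and let $(\mathcal{A},P,\alpha)$ be an injective semigroup dynamical system whose projections are aligned and such that $\alpha_p(\mathcal{A})$ is hereditary in $\mathcal{A}$ for every $p\in P$. Let $(\pi,V)$ be an isometric right covariant representation of $(\mathcal{A},P,\alpha)$ on a Hilbert space $\mathcal{H}$ and let $q\in P$ be such that $V(q)V(q)^*\neq\pi(\alpha_q(1))$ (the projection $V(q)V(q)^*$ is always dominated by $\pi(\alpha_q(1))$). Let $\mathcal{L}_1=(\pi(\alpha_q(1))-V(q)V(q)^* )\mathcal{H}$ and let $T:\mathcal{L}_1\to\mathcal{H}$ be the inclusion map. Define, on $\mathcal{H}_1=\mathcal{H}\oplus\mathcal{L}_1$, for $a\in\mathcal{A}$ and $p\in P$, $$\pi_1(a)=\begin{bmatrix}\pi(a)&0\\0&T^*\pi(\alpha_q(a))T\end{bmatrix},\qquad V_1(p)=\begin{bmatrix}V(p)&V(q)^*V(p)T\\0&T^*V(p)T\end{bmatrix}.$$ Then the pair $(\pi_1,V_1)$ is also an isometric right covariant representation of $(\mathcal{A},P,\alpha)$.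
   Context: A semigroup dynamical system is a triple $(\mathcal{A},P,\alpha)$ where $\mathcal{A}$ is a unital $C^*$-algebra, $P$ is a semigroup with identity $e$, and $\alpha$ is an action of $P$ on $\mathcal{A}$ by (not necessarily unital) $*$-endomorphisms $\alpha_p$ ($\alpha_{pq}=\alpha_p\circ\alpha_q$, $\alpha_e=\mathrm{id}$). It is injective if every $\alpha_p$ is injective. Its projections are aligned if $\alpha_p(1)$ and $\alpha_q(1)$ commute for all $p,q\in P$. A subalgebra $\mathcal{B}\subset\mathcal{A}$ is hereditary if $0\le a\le b$ with $a\in\mathcal{A}$, $b\in\mathcal{B}$ implies $a\in\mathcal{B}$. An isometric right covariant representation is a pair $(\pi,V)$ where $\pi:\mathcal{A}\to\mathcal{B}(\mathcal{H})$ is a unital $*$-homomorphism, $V:P\to\mathcal{B}(\mathcal{H})$ is an isometric representation (each $V(p)$ is an isometry, $V(pq)=V(p)V(q)$) with $V(e)=I$, and $V(p)\pi(a)=\pi(\alpha_p(a))V(p)$ for all $p\in P$, $a\in\mathcal{A}$. *)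

theory Defs
  imports "HOL-Analysis.Analysis"
begin

section \<open>Complex vector spaces and Hilbert spaces\<close>

class complex_vector = real_vector +
  fixes scaleC :: "complex \<Rightarrow> 'a \<Rightarrow> 'a"  (infixr "*\<^sub>C" 75)
  assumes scaleC_add_right: "c *\<^sub>C (x + y) = c *\<^sub>C x + c *\<^sub>C y"
    and scaleC_add_left: "(c + d) *\<^sub>C x = c *\<^sub>C x + d *\<^sub>C x"
    and scaleC_scaleC: "c *\<^sub>C (d *\<^sub>C x) = (c * d) *\<^sub>C x"
    and scaleC_one: "1 *\<^sub>C x = x"
    and scaleR_scaleC: "r *\<^sub>R x = complex_of_real r *\<^sub>C x"

class complex_normed_vector = complex_vector + real_normed_vector +
  assumes norm_scaleC: "norm (c *\<^sub>C x) = cmod c * norm x"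

text \<open>The inner product is linear in its first argument.\<close>

class complex_inner = complex_normed_vector +
  fixes cinner :: "'a \<Rightarrow> 'a \<Rightarrow> complex"
  assumes cinner_commute: "cinner x y = cnj (cinner y x)"
    and cinner_add_left: "cinner (x + y) z = cinner x z + cinner y z"
    and cinner_scaleC_left: "cinner (c *\<^sub>C x) y = c * cinner x y"
    and cinner_self: "cinner x x = complex_of_real ((norm x)\<^sup>2)"

class chilbert_space = complex_inner + complete_space

text \<open>The Hilbert space direct sum; the norm is the one the library puts on products,
  \<open>norm (x, y) = sqrt ((norm x)\<^sup>2 + (norm y)\<^sup>2)\<close>.\<close>

instantiation prod :: (complex_vector, complex_vector) complex_vector
begin

definition scaleC_prod :: "complex \<Rightarrow> 'a \<times> 'b \<Rightarrow> 'a \<times> 'b" where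
  "scaleC_prod c z = (c *\<^sub>C fst z, c *\<^sub>C snd z)"

instance
  by standard
    (simp_all add: scaleC_prod_def prod_eq_iff scaleC_add_right scaleC_add_left scaleC_scaleC
      scaleC_one scaleR_scaleC)

end

instance prod :: (complex_normed_vector, complex_normed_vector) complex_normed_vector
proof
  fix c :: complex and z :: "'a \<times> 'b"
  have "(norm (c *\<^sub>C fst z))\<^sup>2 + (norm (c *\<^sub>C snd z))\<^sup>2
      = (cmod c)\<^sup>2 * ((norm (fst z))\<^sup>2 + (norm (snd z))\<^sup>2)"
    by (simp add: norm_scaleC power_mult_distrib distrib_left)
  then show "norm (c *\<^sub>C z) = cmod c * norm z"
    by (simp add: scaleC_prod_def norm_prod_def real_sqrt_mult)
qed

instantiation prod :: (complex_inner, complex_inner) complex_inner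
begin

definition cinner_prod :: "'a \<times> 'b \<Rightarrow> 'a \<times> 'b \<Rightarrow> complex" where
  "cinner_prod z w = cinner (fst z) (fst w) + cinner (snd z) (snd w)"

instance
proof
  fix x y z :: "'a \<times> 'b" and c :: complex
  show "cinner x y = cnj (cinner y x)"
    using cinner_commute[of "fst x" "fst y"] cinner_commute[of "snd x" "snd y"]
    by (simp add: cinner_prod_def)
  show "cinner (x + y) z = cinner x z + cinner y z"
    by (simp add: cinner_prod_def cinner_add_left)
  show "cinner (c *\<^sub>C x) y = c * cinner x y"
    by (simp add: cinner_prod_def scaleC_prod_def cinner_scaleC_left distrib_left)
  show "cinner x x = complex_of_real ((norm x)\<^sup>2)"
    by (simp add: cinner_prod_def cinner_self norm_prod_def)
qed

end

instance prod :: (chilbert_space, chilbert_space) chilbert_space ..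


section \<open>Unital C*-algebras\<close>

text \<open>Building on \<^class>\<open>monoid_mult\<close> rather than on \<^class>\<open>real_normed_algebra_1\<close> keeps the
  zero algebra; \<open>norm 1 = 1\<close> follows from the C*-identity in every nonzero algebra.\<close>

class unital_cstar_algebra = complex_normed_vector + real_normed_algebra + monoid_mult +
  complete_space +
  fixes star :: "'a \<Rightarrow> 'a"
  assumes mult_scaleC_left: "(c *\<^sub>C a) * b = c *\<^sub>C (a * b)"
    and mult_scaleC_right: "a * (c *\<^sub>C b) = c *\<^sub>C (a * b)"
    and star_star: "star (star a) = a"
    and star_add: "star (a + b) = star a + star b"
    and star_scaleC: "star (c *\<^sub>C a) = cnj c *\<^sub>C star a"
    and star_mult: "star (a * b) = star b * star a"
    and cstar_identity: "norm (star a * a) = (norm a)\<^sup>2"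

definition cstar_positive :: "'a::unital_cstar_algebra \<Rightarrow> bool" where
  "cstar_positive a \<longleftrightarrow> (\<exists>x. a = star x * x)"

definition hereditary :: "'a::unital_cstar_algebra set \<Rightarrow> bool" where
  "hereditary B \<longleftrightarrow>
     (\<forall>a b. b \<in> B \<and> cstar_positive a \<and> cstar_positive (b - a) \<longrightarrow> a \<in> B)"

definition star_endomorphism :: "('a::unital_cstar_algebra \<Rightarrow> 'a) \<Rightarrow> bool" where
  "star_endomorphism f \<longleftrightarrow>
     (\<forall>a b. f (a + b) = f a + f b) \<and> (\<forall>c a. f (c *\<^sub>C a) = c *\<^sub>C f a) \<and>
     (\<forall>a b. f (a * b) = f a * f b) \<and> (\<forall>a. f (star a) = star (f a))"


section \<open>Semigroup dynamical systems\<close>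

definition semigroup_dynamical_system ::
    "('p::monoid_mult \<Rightarrow> 'a::unital_cstar_algebra \<Rightarrow> 'a) \<Rightarrow> bool" where
  "semigroup_dynamical_system \<alpha> \<longleftrightarrow>
     (\<forall>p. star_endomorphism (\<alpha> p)) \<and> (\<forall>p q. \<alpha> (p * q) = \<alpha> p \<circ> \<alpha> q) \<and> \<alpha> 1 = id"

definition injective_system ::
    "('p::monoid_mult \<Rightarrow> 'a::unital_cstar_algebra \<Rightarrow> 'a) \<Rightarrow> bool" where
  "injective_system \<alpha> \<longleftrightarrow> (\<forall>p. inj (\<alpha> p))"

definition aligned_projections ::
    "('p::monoid_mult \<Rightarrow> 'a::unital_cstar_algebra \<Rightarrow> 'a) \<Rightarrow> bool" where
  "aligned_projections \<alpha> \<longleftrightarrow> (\<forall>p q. \<alpha> p 1 * \<alpha> q 1 = \<alpha> q 1 * \<alpha> p 1)"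


section \<open>Operators on closed subspaces\<close>

text \<open>The space \<open>\<H> \<oplus> \<L>\<^sub>1\<close> depends on the representation, so it cannot be a type. A Hilbert space is
  therefore a closed complex subspace \<open>S\<close> of a type of class \<^class>\<open>chilbert_space\<close> (\<open>UNIV\<close> for the
  whole type), and an operator on \<open>S\<close> is a function of which only the values on \<open>S\<close> matter.\<close>

definition closed_csubspace :: "'h::chilbert_space set \<Rightarrow> bool" where
  "closed_csubspace S \<longleftrightarrow>
     closed S \<and> 0 \<in> S \<and> (\<forall>x\<in>S. \<forall>y\<in>S. x + y \<in> S) \<and> (\<forall>c. \<forall>x\<in>S. c *\<^sub>C x \<in> S)"

definition bounded_operator_on :: "'h::chilbert_space set \<Rightarrow> ('h \<Rightarrow> 'h) \<Rightarrow> bool" where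
  "bounded_operator_on S f \<longleftrightarrow>
     f ` S \<subseteq> S \<and> (\<forall>x\<in>S. \<forall>y\<in>S. f (x + y) = f x + f y) \<and>
     (\<forall>c. \<forall>x\<in>S. f (c *\<^sub>C x) = c *\<^sub>C f x) \<and> (\<exists>K. \<forall>x\<in>S. norm (f x) \<le> K * norm x)"

text \<open>The Hilbert space adjoint of an operator \<open>f\<close> with domain \<open>S\<close>, as an operator into \<open>S\<close>.\<close>

definition adjoint_on ::
    "'h::chilbert_space set \<Rightarrow> ('h \<Rightarrow> 'k::chilbert_space) \<Rightarrow> 'k \<Rightarrow> 'h" where
  "adjoint_on S f y = (THE x. x \<in> S \<and> (\<forall>z\<in>S. cinner (f z) y = cinner z x))"

definition operator_le :: "('h::chilbert_space \<Rightarrow> 'h) \<Rightarrow> ('h \<Rightarrow> 'h) \<Rightarrow> bool" where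
  "operator_le f g \<longleftrightarrow> (\<forall>x. cinner (g x - f x) x \<in> \<real> \<and> 0 \<le> Re (cinner (g x - f x) x))"


section \<open>Isometric right covariant representations\<close>

definition unital_star_representation ::
    "'h::chilbert_space set \<Rightarrow> ('a::unital_cstar_algebra \<Rightarrow> 'h \<Rightarrow> 'h) \<Rightarrow> bool" where
  "unital_star_representation S \<pi> \<longleftrightarrow>
     (\<forall>a. bounded_operator_on S (\<pi> a)) \<and>
     (\<forall>a b. \<forall>x\<in>S. \<pi> (a + b) x = \<pi> a x + \<pi> b x) \<and>
     (\<forall>c a. \<forall>x\<in>S. \<pi> (c *\<^sub>C a) x = c *\<^sub>C \<pi> a x) \<and>
     (\<forall>a b. \<forall>x\<in>S. \<pi> (a * b) x = \<pi> a (\<pi> b x)) \<and>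
     (\<forall>a. \<forall>x\<in>S. \<pi> (star a) x = adjoint_on S (\<pi> a) x) \<and>
     (\<forall>x\<in>S. \<pi> 1 x = x)"

definition isometric_representation ::
    "'h::chilbert_space set \<Rightarrow> ('p::monoid_mult \<Rightarrow> 'h \<Rightarrow> 'h) \<Rightarrow> bool" where
  "isometric_representation S V \<longleftrightarrow>
     (\<forall>p. bounded_operator_on S (V p) \<and> (\<forall>x\<in>S. norm (V p x) = norm x)) \<and>
     (\<forall>p q. \<forall>x\<in>S. V (p * q) x = V p (V q x)) \<and>
     (\<forall>x\<in>S. V 1 x = x)"

definition isometric_right_covariant_representation ::
    "'h::chilbert_space set \<Rightarrow> ('p::monoid_mult \<Rightarrow> 'a::unital_cstar_algebra \<Rightarrow> 'a) \<Rightarrow>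
     ('a \<Rightarrow> 'h \<Rightarrow> 'h) \<Rightarrow> ('p \<Rightarrow> 'h \<Rightarrow> 'h) \<Rightarrow> bool" where
  "isometric_right_covariant_representation S \<alpha> \<pi> V \<longleftrightarrow>
     closed_csubspace S \<and> unital_star_representation S \<pi> \<and> isometric_representation S V \<and>
     (\<forall>p a. \<forall>x\<in>S. V p (\<pi> a x) = \<pi> (\<alpha> p a) (V p x))"


section \<open>The extended pair\<close>

definition block_operator ::
    "('h \<Rightarrow> 'h) \<Rightarrow> ('k \<Rightarrow> 'h) \<Rightarrow> ('h \<Rightarrow> 'k) \<Rightarrow> ('k \<Rightarrow> 'k) \<Rightarrow>
     'h::chilbert_space \<times> 'k::chilbert_space \<Rightarrow> 'h \<times> 'k" where
  "block_operator A B C D z = (A (fst z) + B (snd z), C (fst z) + D (snd z))"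

definition L1_space ::
    "('p::monoid_mult \<Rightarrow> 'a::unital_cstar_algebra \<Rightarrow> 'a) \<Rightarrow>
     ('a \<Rightarrow> 'h \<Rightarrow> 'h) \<Rightarrow> ('p \<Rightarrow> 'h \<Rightarrow> 'h) \<Rightarrow> 'p \<Rightarrow> 'h::chilbert_space set" where
  "L1_space \<alpha> \<pi> V q = range (\<lambda>x. \<pi> (\<alpha> q 1) x - V q (adjoint_on UNIV (V q) x))"

text \<open>In both definitions the inclusion \<open>T\<close> is \<open>id\<close> with domain \<open>\<L>\<^sub>1\<close>.\<close>

definition extended_pi ::
    "('p::monoid_mult \<Rightarrow> 'a::unital_cstar_algebra \<Rightarrow> 'a) \<Rightarrow> ('a \<Rightarrow> 'h \<Rightarrow> 'h) \<Rightarrow>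
     ('p \<Rightarrow> 'h \<Rightarrow> 'h) \<Rightarrow> 'p \<Rightarrow> 'a \<Rightarrow> 'h::chilbert_space \<times> 'h \<Rightarrow> 'h \<times> 'h" where
  "extended_pi \<alpha> \<pi> V q a =
     (let T = id; T' = adjoint_on (L1_space \<alpha> \<pi> V q) T in
      block_operator
        (\<pi> a)     (\<lambda>_. 0)
        (\<lambda>_. 0)   (T' \<circ> \<pi> (\<alpha> q a) \<circ> T))"

definition extended_V ::
    "('p::monoid_mult \<Rightarrow> 'a::unital_cstar_algebra \<Rightarrow> 'a) \<Rightarrow> ('a \<Rightarrow> 'h \<Rightarrow> 'h) \<Rightarrow>
     ('p \<Rightarrow> 'h \<Rightarrow> 'h) \<Rightarrow> 'p \<Rightarrow> 'p \<Rightarrow> 'h::chilbert_space \<times> 'h \<Rightarrow> 'h \<times> 'h" where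
  "extended_V \<alpha> \<pi> V q p =
     (let T = id; T' = adjoint_on (L1_space \<alpha> \<pi> V q) T in
      block_operator
        (V p)     (adjoint_on UNIV (V q) \<circ> V p \<circ> T)
        (\<lambda>_. 0)   (T' \<circ> V p \<circ> T))"

end

theory Submission
  imports Defs
begin

text \<open>Write \<open>W = V q\<close>, \<open>E = \<pi> (\<alpha> q 1)\<close> and \<open>D = E - W W\<^sup>*\<close>. Covariance gives \<open>E W = W\<close> and
  \<open>W\<^sup>* \<pi> (\<alpha> q a) = \<pi> a W\<^sup>*\<close>, so \<open>D\<close> is a projection with range \<open>\<L>\<^sub>1\<close> that commutes with every
  \<open>\<pi> (\<alpha> q a)\<close>. As the semigroup is abelian, \<open>E\<close> fixes \<open>V p l\<close> for all \<open>l \<in> \<L>\<^sub>1\<close>, so that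
  \<open>V p l = D (V p l) + W (W\<^sup>* (V p l))\<close> orthogonally. Hence the second column of \<open>V\<^sub>1 p\<close> is isometric;
  it is orthogonal to the first one because \<open>W V p = V p W\<close> and \<open>W\<^sup>*\<close> vanishes on \<open>\<L>\<^sub>1\<close>.\<close>

section \<open>Complex inner product spaces\<close>

lemma scaleC_minus_one: "(- 1) *\<^sub>C x = - (x::'h::complex_vector)"
proof -
  have "(- 1) *\<^sub>C x = complex_of_real (- 1) *\<^sub>C x" by simp
  also have "\<dots> = - x" by (simp only: scaleR_scaleC[symmetric]) simp
  finally show ?thesis .
qed

lemma scaleC_minus_right: "c *\<^sub>C (- x) = - (c *\<^sub>C (x::'h::complex_vector))"
  by (metis mult.commute scaleC_minus_one scaleC_scaleC)

lemma scaleC_diff_right: "c *\<^sub>C (x - y) = c *\<^sub>C x - c *\<^sub>C (y::'h::complex_vector)"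
  using scaleC_add_right[of c x "- y"] by (simp add: scaleC_minus_right)

lemma cinner_minus_left: "cinner (- x) (y::'h::complex_inner) = - cinner x y"
  using cinner_scaleC_left[of "- 1" x y] by (simp add: scaleC_minus_one)

lemma cinner_diff_left: "cinner (x - y) (z::'h::complex_inner) = cinner x z - cinner y z"
  using cinner_add_left[of x "- y" z] by (simp add: cinner_minus_left)

lemma cinner_add_right: "cinner x (y + z) = cinner x y + cinner x (z::'h::complex_inner)"
  by (metis cinner_add_left cinner_commute complex_cnj_add)

lemma cinner_diff_right: "cinner x (y - z) = cinner x y - cinner x (z::'h::complex_inner)"
  by (metis cinner_diff_left cinner_commute complex_cnj_diff)

lemma cinner_scaleC_right: "cinner x (c *\<^sub>C y) = cnj c * cinner x (y::'h::complex_inner)"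
  by (metis cinner_scaleC_left cinner_commute complex_cnj_mult)

lemma Re_cinner_self: "Re (cinner x (x::'h::complex_inner)) = (norm x)\<^sup>2"
  by (simp add: cinner_self)

lemma Re_cinner_commute: "Re (cinner x y) = Re (cinner y (x::'h::complex_inner))"
  by (subst cinner_commute) simp

text \<open>Identities between complex inner products thereby reduce to real parts, at
  \<open>x\<close> and at \<open>\<i> *\<^sub>C x\<close>.\<close>

lemma Im_cinner_eq: "Im (cinner x y) = - Re (cinner (\<i> *\<^sub>C x) (y::'h::complex_inner))"
  by (simp add: cinner_scaleC_left)

lemma power2_norm_add:
  "(norm (x + y))\<^sup>2 = (norm x)\<^sup>2 + 2 * Re (cinner x y) + (norm (y::'h::complex_inner))\<^sup>2"
proof -
  have "Re (cinner (x + y) (x + y)) = Re (cinner x x) + Re (cinner x y) + Re (cinner y x) + Re (cinner y y)"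
    by (simp add: cinner_add_left cinner_add_right)
  then show ?thesis
    using Re_cinner_commute[of x y] by (simp add: Re_cinner_self)
qed

lemma power2_norm_add_scaleR:
  "(norm (x + t *\<^sub>R y))\<^sup>2
    = (norm x)\<^sup>2 + 2 * t * Re (cinner x y) + t\<^sup>2 * (norm (y::'h::complex_inner))\<^sup>2"
  by (simp add: power2_norm_add scaleR_scaleC[of t y] cinner_scaleC_right norm_scaleC
      power_mult_distrib)

lemma parallelogram_law:
  "(norm (x + y))\<^sup>2 + (norm (x - y))\<^sup>2 = 2 * (norm x)\<^sup>2 + 2 * (norm (y::'h::complex_inner))\<^sup>2"
  using power2_norm_add[of x y] power2_norm_add_scaleR[of x "- 1" y] by simp

lemma cinner_eqI:
  fixes x y :: "'h::complex_inner"
  assumes "\<And>z. cinner z x = cinner z y"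
  shows "x = y"
proof -
  have "cinner (x - y) (x - y) = 0"
    using assms by (simp add: cinner_diff_right)
  then show ?thesis by (simp add: cinner_self)
qed

text \<open>The quadratic attains its minimum 0 at \<open>t = 0\<close>, so its derivative
  \<open>2 * b\<close> there vanishes. This is the variational step in the Riesz theorem.\<close>

lemma linear_coeff_eq_0:
  fixes a b :: real
  assumes "\<And>t. 0 \<le> 2 * t * b + t\<^sup>2 * a"
  shows "b = 0"
proof (rule ccontr)
  assume "b \<noteq> 0"
  \<comment> \<open>Any \<open>c > 0\<close> with \<open>a < 2 * c\<close> would do: it makes the
    value at \<open>t = - b / c\<close> negative.\<close>
  define c where "c = \<bar>a\<bar> + 1"
  have c: "c > 0" "a < 2 * c" by (auto simp: c_def)
  have "2 * (- b / c) * b + (- b / c)\<^sup>2 * a = (b / c)\<^sup>2 * (a - 2 * c)"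
    using c by (simp add: field_simps power2_eq_square)
  moreover have "(b / c)\<^sup>2 * (a - 2 * c) < 0"
    using c \<open>b \<noteq> 0\<close> by (intro mult_pos_neg) auto
  ultimately show False using assms[of "- b / c"] by linarith
qed

lemma Re_cinner_le: "Re (cinner x y) \<le> norm x * norm (y::'h::complex_inner)"
proof (rule power2_le_imp_le[THEN order_trans[OF abs_ge_self]])
  show "\<bar>Re (cinner x y)\<bar>\<^sup>2 \<le> (norm x * norm y)\<^sup>2"
  proof (cases "y = 0")
    case True
    \<comment> \<open>Additivity at \<open>0 + 0\<close> forces
      \<open>cinner x 0 = 0\<close>.\<close>
    have "cinner x (0 + 0) = cinner x 0 + cinner x 0" by (rule cinner_add_right)
    then show ?thesis using True by simp
  next
    case False
    \<comment> \<open>The minimiser of the quadratic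
      \<open>(norm (x + t *\<^sub>R y))\<^sup>2\<close> in \<open>t\<close>.\<close>
    define t where "t = - Re (cinner x y) / (norm y)\<^sup>2"
    have "0 \<le> (norm (x + t *\<^sub>R y))\<^sup>2" by simp
    also have "\<dots> = (norm x)\<^sup>2 - (Re (cinner x y))\<^sup>2 / (norm y)\<^sup>2"
      using False unfolding power2_norm_add_scaleR t_def
      by (simp add: field_simps power2_eq_square)
    finally show ?thesis using False
      by (simp add: field_simps power_mult_distrib)
  qed
qed simp

lemma cauchy_schwarz: "cmod (cinner x y) \<le> norm x * norm (y::'h::complex_inner)"
proof -
  \<comment> \<open>Multiplication by \<open>c\<close> rotates the inner product onto the
    nonnegative real axis. As \<open>sgn 0 = 0\<close>, the modulus of \<open>c\<close> is 1 or 0,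
    hence at most 1.\<close>
  define c where "c = cnj (sgn (cinner x y))"
  have "cmod (cinner x y) = Re (cinner (c *\<^sub>C x) y)"
    by (cases "cinner x y = 0")
      (simp_all add: c_def cinner_scaleC_left sgn_eq cmod_def power2_eq_square real_div_sqrt
        flip: add_divide_distrib)
  also have "\<dots> \<le> norm (c *\<^sub>C x) * norm y" by (rule Re_cinner_le)
  also have "\<dots> \<le> norm x * norm y"
    by (auto simp: norm_scaleC c_def norm_sgn intro!: mult_right_mono)
  finally show ?thesis .
qed

text \<open>Polarization: norms of sums determine the real part, and \<open>\<i> *\<^sub>C x\<close>
  supplies the imaginary part.\<close>

lemma linear_isometry_cinner:
  fixes f :: "'h::complex_inner \<Rightarrow> 'k::complex_inner"
  assumes add: "\<And>x y. f (x + y) = f x + f y"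
    and scale: "\<And>c x. f (c *\<^sub>C x) = c *\<^sub>C f x"
    and iso: "\<And>x. norm (f x) = norm x"
  shows "cinner (f x) (f y) = cinner x y"
proof -
  have Re: "Re (cinner (f x) (f y)) = Re (cinner x y)" for x y
    using power2_norm_add[of "f x" "f y"] power2_norm_add[of x y] iso[of "x + y"]
    by (simp add: add iso)
  show ?thesis
    using Re[of x y] Re[of "\<i> *\<^sub>C x" y] by (simp add: complex_eq_iff scale Im_cinner_eq)
qed

section \<open>The Riesz representation theorem and adjoints\<close>

lemma closed_csubspace_UNIV: "closed_csubspace UNIV"
  by (simp add: closed_csubspace_def)

lemma closed_csubspace_diff:
  "closed_csubspace S \<Longrightarrow> x \<in> S \<Longrightarrow> y \<in> S \<Longrightarrow> x - y \<in> S"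
  unfolding closed_csubspace_def by (metis scaleC_minus_one uminus_add_conv_diff add.commute)

lemma closed_csubspace_scaleR: "closed_csubspace S \<Longrightarrow> x \<in> S \<Longrightarrow> r *\<^sub>R x \<in> S"
  unfolding closed_csubspace_def by (simp add: scaleR_scaleC)

text \<open>The representing vector minimises \<open>\<bar>x\<bar>\<^sup>2 - 2 Re \<phi> x\<close>; by the parallelogram law every
  minimising sequence is Cauchy.\<close>

lemma riesz_representation:
  fixes \<phi> :: "'h::chilbert_space \<Rightarrow> complex"
  assumes S: "closed_csubspace S"
    and add: "\<And>x y. x \<in> S \<Longrightarrow> y \<in> S \<Longrightarrow> \<phi> (x + y) = \<phi> x + \<phi> y"
    and scale: "\<And>c x. x \<in> S \<Longrightarrow> \<phi> (c *\<^sub>C x) = c * \<phi> x"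
    and bounded: "\<And>x. x \<in> S \<Longrightarrow> cmod (\<phi> x) \<le> K * norm x"
  shows "\<exists>x\<in>S. \<forall>z\<in>S. \<phi> z = cinner z x"
proof -
  define F where "F x = (norm x)\<^sup>2 - 2 * Re (\<phi> x)" for x
  have S0: "0 \<in> S" and Sadd: "\<And>x y. x \<in> S \<Longrightarrow> y \<in> S \<Longrightarrow> x + y \<in> S"
    and SC: "\<And>c x. x \<in> S \<Longrightarrow> c *\<^sub>C x \<in> S" and "closed S"
    using S by (auto simp: closed_csubspace_def)
  have SR: "\<And>r x. x \<in> S \<Longrightarrow> r *\<^sub>R x \<in> S" using S by (rule closed_csubspace_scaleR)
  have Sdiff: "\<And>x y. x \<in> S \<Longrightarrow> y \<in> S \<Longrightarrow> x - y \<in> S" using S by (rule closed_csubspace_diff)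
  have scaleR: "\<phi> (r *\<^sub>R x) = of_real r * \<phi> x" if "x \<in> S" for r x
    using that by (simp add: scaleR_scaleC scale)
  have diff: "\<phi> (x - y) = \<phi> x - \<phi> y" if "x \<in> S" "y \<in> S" for x y
    using add[OF Sdiff[OF that] that(2)] by simp
  \<comment> \<open>Completing the square; this makes the infimum \<open>m\<close> a genuine lower
    bound of \<open>F\<close> on \<open>S\<close>.\<close>
  have lower: "- K\<^sup>2 \<le> F x" if "x \<in> S" for x
  proof -
    have "Re (\<phi> x) \<le> K * norm x"
      using bounded[OF that] complex_Re_le_cmod order_trans by blast
    moreover have "0 \<le> (norm x - K)\<^sup>2" by simp
    ultimately show ?thesis
      by (simp add: F_def power2_diff mult.commute)
  qed
  define m where "m = (INF x\<in>S. F x)"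
  have bdd: "bdd_below (F ` S)" using lower by (auto intro!: bdd_belowI2)
  have m_le: "m \<le> F x" if "x \<in> S" for x
    unfolding m_def using bdd that by (rule cINF_lower)
  have "\<exists>x\<in>S. F x < m + e" if "e > 0" for e
    using that cINF_less_iff[of S F "m + e"] bdd S0 by (auto simp: m_def)
  then have "\<exists>x\<in>S. F x < m + inverse (real (Suc n))" for n
    by (metis inverse_positive_iff_positive of_nat_0_less_iff zero_less_Suc)
  then obtain X where X: "\<And>n. X n \<in> S" "\<And>n. F (X n) < m + inverse (real (Suc n))"
    by metis
  \<comment> \<open>The midpoint of \<open>x\<close> and \<open>y\<close> lies in \<open>S\<close>,
    so \<open>F\<close> is at least \<open>m\<close> there; the parallelogram law converts this into
    a bound on the distance.\<close>
  have par: "(norm (x - y))\<^sup>2 \<le> 2 * (F x - m) + 2 * (F y - m)" if "x \<in> S" "y \<in> S" for x y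
  proof -
    have "m \<le> F ((1/2) *\<^sub>R (x + y))" using that by (intro m_le SR Sadd)
    also have "\<dots> = (norm (x + y))\<^sup>2 / 4 - Re (\<phi> x) - Re (\<phi> y)"
      using that by (simp add: F_def scaleR Sadd add power2_eq_square add_divide_distrib)
    finally show ?thesis using parallelogram_law[of x y] by (simp add: F_def)
  qed
  have "Cauchy X"
  proof (rule CauchyI)
    fix e :: real assume "e > 0"
    \<comment> \<open>Two deviations below \<open>e\<^sup>2 / 4\<close>, each doubled in
      \<open>par\<close>, add up to less than \<open>e\<^sup>2\<close>.\<close>
    then obtain N where N: "inverse (real (Suc N)) < e\<^sup>2 / 4"
      using reals_Archimedean[of "e\<^sup>2 / 4"] by auto
    have small: "F (X n) - m < e\<^sup>2 / 4" if "n \<ge> N" for n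
    proof -
      have "inverse (real (Suc n)) \<le> inverse (real (Suc N))" using that by simp
      then show ?thesis using X(2)[of n] N by linarith
    qed
    have "norm (X i - X j) < e" if "i \<ge> N" "j \<ge> N" for i j
    proof (rule power2_less_imp_less)
      show "(norm (X i - X j))\<^sup>2 < e\<^sup>2"
        using par[OF X(1) X(1), of i j] small[OF that(1)] small[OF that(2)] by argo
    qed (use \<open>e > 0\<close> in simp)
    then show "\<exists>M. \<forall>i\<ge>M. \<forall>j\<ge>M. norm (X i - X j) < e" by blast
  qed
  then obtain x where lim: "X \<longlonglongrightarrow> x"
    using Cauchy_convergent convergent_def by blast
  have "x \<in> S" using \<open>closed S\<close> X(1) lim by (meson closed_sequentially)
  \<comment> \<open>Boundedness makes \<phi> continuous along the sequence, so
    \<open>F (X n)\<close> tends to \<open>F x\<close> and the infimum is attained at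
    \<open>x\<close>.\<close>
  have "(\<lambda>n. \<phi> (X n) - \<phi> x) \<longlonglongrightarrow> 0"
  proof (rule Lim_null_comparison)
    show "\<forall>\<^sub>F n in sequentially. norm (\<phi> (X n) - \<phi> x) \<le> K * norm (X n - x)"
      using bounded[OF Sdiff[OF X(1) \<open>x \<in> S\<close>]] by (simp add: diff[OF X(1) \<open>x \<in> S\<close>])
    have "(\<lambda>n. K * norm (X n - x)) \<longlonglongrightarrow> K * norm (x - x)"
      by (intro tendsto_intros lim)
    then show "(\<lambda>n. K * norm (X n - x)) \<longlonglongrightarrow> 0" by simp
  qed
  then have "(\<lambda>n. \<phi> (X n)) \<longlonglongrightarrow> \<phi> x" by (simp add: LIM_zero_iff)
  then have "(\<lambda>n. F (X n)) \<longlonglongrightarrow> F x"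
    unfolding F_def by (intro tendsto_intros lim)
  moreover have "(\<lambda>n. m + inverse (real (Suc n))) \<longlonglongrightarrow> m + 0"
    by (intro tendsto_intros LIMSEQ_inverse_real_of_nat)
  ultimately have "F x \<le> m + 0"
    by (rule LIMSEQ_le) (use X(2) less_imp_le in blast)
  have Re: "Re (\<phi> z) = Re (cinner z x)" if "z \<in> S" for z
  proof -
    \<comment> \<open>The right-hand side is \<open>F (x + t *\<^sub>R z) - F x\<close>, nonnegative
      because \<open>x\<close> minimises \<open>F\<close>.\<close>
    have "0 \<le> 2 * t * (Re (cinner x z) - Re (\<phi> z)) + t\<^sup>2 * (norm z)\<^sup>2" for t
    proof -
      have "F x \<le> F (x + t *\<^sub>R z)"
        using \<open>F x \<le> m + 0\<close> m_le[OF Sadd[OF \<open>x \<in> S\<close> SR[OF that, of t]]] by simp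
      then show ?thesis
        using that \<open>x \<in> S\<close> by (simp add: F_def power2_norm_add_scaleR add SR scaleR algebra_simps)
    qed
    then have "Re (cinner x z) - Re (\<phi> z) = 0" by (rule linear_coeff_eq_0)
    then show ?thesis using Re_cinner_commute[of x z] by simp
  qed
  have "\<phi> z = cinner z x" if "z \<in> S" for z
    using Re[OF that] Re[OF SC[OF that], of \<i>] that
    by (simp add: complex_eq_iff scale cinner_scaleC_left)
  then show ?thesis using \<open>x \<in> S\<close> by blast
qed

text \<open>The difference of two candidates lies in \<open>S\<close> and is orthogonal to itself.
  Concrete adjoints are later identified by exhibiting a candidate.\<close>

lemma adjoint_on_eqI:
  assumes S: "closed_csubspace S" and x: "x \<in> S"
    and adj: "\<And>z. z \<in> S \<Longrightarrow> cinner (f z) y = cinner z x"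
  shows "adjoint_on S f y = x"
  unfolding adjoint_on_def
proof (rule the_equality)
  fix x' assume x': "x' \<in> S \<and> (\<forall>z\<in>S. cinner (f z) y = cinner z x')"
  then have "cinner (x' - x) (x' - x) = 0"
    using adj[of "x' - x"] closed_csubspace_diff[OF S _ x] by (simp add: cinner_diff_right)
  then show "x' = x" by (simp add: cinner_self)
qed (use x adj in blast)

text \<open>Riesz, applied to \<open>\<lambda>z. cinner (f z) y\<close>, shows that the definite
  description in \<open>adjoint_on\<close> denotes; Cauchy-Schwarz gives the bound on this
  functional.\<close>

lemma cinner_adjoint_on:
  assumes S: "closed_csubspace S" and f: "bounded_operator_on S f" and z: "z \<in> S"
  shows "cinner (f z) y = cinner z (adjoint_on S f y)"
proof -
  obtain K where K: "\<And>x. x \<in> S \<Longrightarrow> norm (f x) \<le> K * norm x"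
    using f unfolding bounded_operator_on_def by blast
  have "\<exists>x\<in>S. \<forall>z\<in>S. cinner (f z) y = cinner z x"
  proof (rule riesz_representation[OF S, where K = "K * norm y"])
    fix x assume "x \<in> S"
    have "cmod (cinner (f x) y) \<le> norm (f x) * norm y" by (rule cauchy_schwarz)
    also have "\<dots> \<le> K * norm x * norm y" using K[OF \<open>x \<in> S\<close>] by (rule mult_right_mono) simp
    finally show "cmod (cinner (f x) y) \<le> K * norm y * norm x" by (simp add: mult_ac)
  qed (use f in \<open>simp_all add: bounded_operator_on_def cinner_add_left cinner_scaleC_left\<close>)
  then obtain x where x: "x \<in> S" "\<And>z. z \<in> S \<Longrightarrow> cinner (f z) y = cinner z x" by blast
  then have "adjoint_on S f y = x" by (intro adjoint_on_eqI S)
  then show ?thesis using x(2)[OF z] by simp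
qed

section \<open>Extending a covariant representation\<close>

locale covariant_pair =
  fixes \<alpha> :: "'p::comm_monoid_mult \<Rightarrow> 'a::unital_cstar_algebra \<Rightarrow> 'a"
    and \<pi> :: "'a \<Rightarrow> 'h::chilbert_space \<Rightarrow> 'h"
    and V :: "'p \<Rightarrow> 'h \<Rightarrow> 'h"
  assumes system: "semigroup_dynamical_system \<alpha>"
    and rep: "isometric_right_covariant_representation UNIV \<alpha> \<pi> V"
begin

section \<open>Rules for the given system and representation\<close>

lemma endo:
  shows \<alpha>_add: "\<alpha> p (a + b) = \<alpha> p a + \<alpha> p b"
    and \<alpha>_scaleC: "\<alpha> p (c *\<^sub>C a) = c *\<^sub>C \<alpha> p a"
    and \<alpha>_mult: "\<alpha> p (a * b) = \<alpha> p a * \<alpha> p b"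
    and \<alpha>_star: "\<alpha> p (star a) = star (\<alpha> p a)"
    and \<alpha>_times: "\<alpha> (p * r) a = \<alpha> p (\<alpha> r a)"
  using system by (simp_all add: semigroup_dynamical_system_def star_endomorphism_def)

text \<open>Commutativity of the semigroup enters only through this fact and
  \<open>V_commute\<close>.\<close>

lemma \<alpha>_commute: "\<alpha> p (\<alpha> r a) = \<alpha> r (\<alpha> p a)"
  by (metis \<alpha>_times mult.commute)

lemma rep_simps:
  shows \<pi>_bounded: "bounded_operator_on UNIV (\<pi> a)"
    and \<pi>_plus: "\<pi> (a + b) x = \<pi> a x + \<pi> b x"
    and \<pi>_scale: "\<pi> (c *\<^sub>C a) x = c *\<^sub>C \<pi> a x"
    and \<pi>_mult: "\<pi> (a * b) x = \<pi> a (\<pi> b x)"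
    and \<pi>_star: "\<pi> (star a) x = adjoint_on UNIV (\<pi> a) x"
    and \<pi>_one: "\<pi> 1 x = x"
    and V_bounded: "bounded_operator_on UNIV (V p)"
    and V_norm: "norm (V p x) = norm x"
    and V_times: "V (p * r) x = V p (V r x)"
    and V_one: "V 1 x = x"
    and covariant: "V p (\<pi> a x) = \<pi> (\<alpha> p a) (V p x)"
  using rep by (simp_all add: isometric_right_covariant_representation_def
      unital_star_representation_def isometric_representation_def)

lemma operator_linear:
  shows \<pi>_add: "\<pi> a (x + y) = \<pi> a x + \<pi> a y"
    and \<pi>_scaleC: "\<pi> a (c *\<^sub>C x) = c *\<^sub>C \<pi> a x"
    and V_add: "V p (x + y) = V p x + V p y"
    and V_scaleC: "V p (c *\<^sub>C x) = c *\<^sub>C V p x"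
  using \<pi>_bounded V_bounded by (simp_all add: bounded_operator_on_def)

lemma V_commute: "V p (V r x) = V r (V p x)"
  by (metis V_times mult.commute)

lemma \<pi>_diff: "\<pi> a (x - y) = \<pi> a x - \<pi> a y"
  by (metis \<pi>_add add_diff_cancel diff_add_cancel)

lemma V_diff: "V p (x - y) = V p x - V p y"
  by (metis V_add add_diff_cancel diff_add_cancel)

lemma \<pi>_adjoint: "cinner (\<pi> a x) y = cinner x (\<pi> (star a) y)"
  by (simp add: \<pi>_star cinner_adjoint_on[OF closed_csubspace_UNIV \<pi>_bounded])

lemma cinner_V: "cinner (V p x) (V p y) = cinner x y"
  by (intro linear_isometry_cinner V_add V_scaleC V_norm)

section \<open>Adjoints of the isometries\<close>

abbreviation Vadj :: "'p \<Rightarrow> 'h \<Rightarrow> 'h" where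
  "Vadj p \<equiv> adjoint_on UNIV (V p)"

lemma V_adjoint: "cinner (V p x) y = cinner x (Vadj p y)"
  by (simp add: cinner_adjoint_on[OF closed_csubspace_UNIV V_bounded])

lemma V_adjoint': "cinner y (V p x) = cinner (Vadj p y) x"
  by (metis V_adjoint cinner_commute)

lemma Vadj_V: "Vadj p (V p x) = x"
  by (rule cinner_eqI) (simp add: V_adjoint[symmetric] cinner_V)

lemma Vadj_add: "Vadj p (x + y) = Vadj p x + Vadj p y"
  by (rule cinner_eqI) (simp add: V_adjoint[symmetric] cinner_add_right)

lemma Vadj_diff: "Vadj p (x - y) = Vadj p x - Vadj p y"
  by (rule cinner_eqI) (simp add: V_adjoint[symmetric] cinner_diff_right)

lemma Vadj_scaleC: "Vadj p (c *\<^sub>C x) = c *\<^sub>C Vadj p x"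
  by (rule cinner_eqI) (simp add: V_adjoint[symmetric] cinner_scaleC_right)

text \<open>The adjoint of the covariance relation at \<open>star a\<close>, since
  \<open>\<alpha> p\<close> commutes with \<open>star\<close>.\<close>

lemma Vadj_\<pi>: "Vadj p (\<pi> (\<alpha> p a) x) = \<pi> a (Vadj p x)"
proof (rule cinner_eqI)
  fix z
  have "cinner z (Vadj p (\<pi> (\<alpha> p a) x)) = cinner (\<pi> (\<alpha> p (star a)) (V p z)) x"
    by (simp add: V_adjoint[symmetric] \<pi>_adjoint \<alpha>_star star_star)
  also have "\<dots> = cinner z (\<pi> a (Vadj p x))"
    by (simp add: covariant[symmetric] V_adjoint \<pi>_adjoint star_star)
  finally show "cinner z (Vadj p (\<pi> (\<alpha> p a) x)) = cinner z (\<pi> a (Vadj p x))" .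
qed

section \<open>The projection \<open>D\<close> of the overview, formed at an arbitrary
  \<open>p\<close>\<close>

definition defect :: "'p \<Rightarrow> 'h \<Rightarrow> 'h" where
  "defect p x = \<pi> (\<alpha> p 1) x - V p (Vadj p x)"

lemma \<pi>_\<alpha>_one_V: "\<pi> (\<alpha> p 1) (V p x) = V p x"
  by (metis covariant \<pi>_one)

lemma \<pi>_\<alpha>_one_idem: "\<pi> (\<alpha> p a) (\<pi> (\<alpha> p 1) x) = \<pi> (\<alpha> p a) x"
  "\<pi> (\<alpha> p 1) (\<pi> (\<alpha> p a) x) = \<pi> (\<alpha> p a) x"
  by (simp_all add: \<pi>_mult[symmetric] \<alpha>_mult[symmetric])

lemma Vadj_defect: "Vadj p (defect p x) = 0"
  using Vadj_\<pi>[of p 1 x] by (simp add: defect_def Vadj_diff Vadj_V \<pi>_one)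

lemma defect_V: "defect p (V p x) = 0"
  by (simp add: defect_def \<pi>_\<alpha>_one_V Vadj_V)

lemma \<pi>_one_defect: "\<pi> (\<alpha> p 1) (defect p x) = defect p x"
  by (simp add: defect_def \<pi>_diff \<pi>_\<alpha>_one_V \<pi>_\<alpha>_one_idem)

lemma defect_idem: "defect p (defect p x) = defect p x"
  \<comment> \<open>The instance of \<open>V_diff\<close> at zeros yields
    \<open>V p 0 = 0\<close>.\<close>
  using Vadj_defect[of p x] \<pi>_one_defect[of p x] V_diff[of p 0 0]
  by (simp add: defect_def[of p "defect p x"])

lemma defect_add: "defect p (x + y) = defect p x + defect p y"
  by (simp add: defect_def \<pi>_add Vadj_add V_add)

lemma defect_diff: "defect p (x - y) = defect p x - defect p y"
  by (simp add: defect_def \<pi>_diff Vadj_diff V_diff)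

lemma defect_scaleC: "defect p (c *\<^sub>C x) = c *\<^sub>C defect p x"
  by (simp add: defect_def \<pi>_scaleC Vadj_scaleC V_scaleC scaleC_diff_right)

lemma star_one: "star 1 = (1::'a)"
  by (metis mult.left_neutral mult.right_neutral star_mult star_star)

lemma defect_selfadjoint: "cinner (defect p x) y = cinner x (defect p y)"
  using \<pi>_adjoint[of "\<alpha> p 1" x y]
  by (simp add: defect_def cinner_diff_left cinner_diff_right V_adjoint V_adjoint'
      \<alpha>_star[symmetric] star_one)

text \<open>\<open>\<pi> (\<alpha> p a)\<close> passes the adjoint as \<open>\<pi> a\<close> and
  returns to its original form when it passes \<open>V p\<close>; on either side it absorbs
  \<open>\<pi> (\<alpha> p 1)\<close>.\<close>

lemma defect_commute: "defect p (\<pi> (\<alpha> p a) x) = \<pi> (\<alpha> p a) (defect p x)"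
  by (simp add: defect_def \<pi>_diff Vadj_\<pi> covariant \<pi>_\<alpha>_one_idem)

lemma cinner_defect: "cinner (defect p x) x = complex_of_real ((norm (defect p x))\<^sup>2)"
  by (metis defect_idem defect_selfadjoint cinner_self)

text \<open>The difference of the two operators is \<open>defect p\<close>, whose quadratic form is
  a squared norm because it is a selfadjoint idempotent.\<close>

lemma range_projection_le: "operator_le (V p \<circ> Vadj p) (\<pi> (\<alpha> p 1))"
  using cinner_defect[of p] by (simp add: operator_le_def defect_def)

section \<open>The closed subspace of fixed points of the projection\<close>

lemma L1_space_eq: "L1_space \<alpha> \<pi> V p = {x. defect p x = x}"
  unfolding L1_space_def defect_def[symmetric] by (auto simp: defect_idem) (metis rangeI)

lemma norm_defect_le: "norm (defect p x) \<le> norm x"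
proof (cases "defect p x = 0")
  case False
  have "(norm (defect p x))\<^sup>2 = Re (cinner (defect p x) x)" by (simp add: cinner_defect)
  also have "\<dots> \<le> norm (defect p x) * norm x" by (rule Re_cinner_le)
  finally show ?thesis using False by (simp add: power2_eq_square)
qed simp

lemma continuous_defect: "continuous_on UNIV (defect p)"
proof (rule continuous_onI)
  fix x and e :: real assume "e > 0"
  then show "\<exists>d>0. \<forall>x'\<in>UNIV. dist x' x < d \<longrightarrow> dist (defect p x') (defect p x) \<le> e"
    using norm_defect_le[of p] by (metis defect_diff dist_norm less_imp_le order_trans)
qed

text \<open>The range of an idempotent is its set of fixed points, and this set is closed because
  \<open>defect p\<close> is a contraction, hence continuous.\<close>

lemma closed_csubspace_L1: "closed_csubspace (L1_space \<alpha> \<pi> V p)"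
  using defect_diff[of p 0 0] unfolding closed_csubspace_def L1_space_eq
  by (auto simp: defect_add defect_scaleC intro!: closed_Collect_eq continuous_defect)

lemma closed_csubspace_Times_L1: "closed_csubspace (UNIV \<times> L1_space \<alpha> \<pi> V p)"
  using closed_csubspace_L1[of p] unfolding closed_csubspace_def
  by (auto simp: scaleC_prod_def zero_prod_def intro!: closed_Times)

text \<open>The adjoint of the inclusion is the orthogonal projection onto the subspace:
  \<open>defect p\<close> is selfadjoint and fixes the subspace pointwise.\<close>

lemma adjoint_inclusion: "adjoint_on (L1_space \<alpha> \<pi> V p) id y = defect p y"
proof (rule adjoint_on_eqI[OF closed_csubspace_L1])
  show "defect p y \<in> L1_space \<alpha> \<pi> V p" by (simp add: L1_space_eq defect_idem)
  fix z assume "z \<in> L1_space \<alpha> \<pi> V p"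
  then show "cinner (id z) y = cinner z (defect p y)"
    using defect_selfadjoint[of p z y] by (simp add: L1_space_eq)
qed

text \<open>The compression \<open>T'\<close> disappears because \<open>\<pi> (\<alpha> q a)\<close>
  leaves the subspace invariant.\<close>

lemma extended_pi_apply:
  assumes "l \<in> L1_space \<alpha> \<pi> V q"
  shows "extended_pi \<alpha> \<pi> V q a (h, l) = (\<pi> a h, \<pi> (\<alpha> q a) l)"
  using assms unfolding L1_space_eq
  by (simp add: extended_pi_def block_operator_def adjoint_inclusion defect_commute)

lemma extended_V_apply:
  "extended_V \<alpha> \<pi> V q p (h, l) = (V p h + Vadj q (V p l), defect q (V p l))"
  by (simp add: extended_V_def block_operator_def adjoint_inclusion)

lemma \<pi>_L1: "l \<in> L1_space \<alpha> \<pi> V q \<Longrightarrow> \<pi> (\<alpha> q a) l \<in> L1_space \<alpha> \<pi> V q"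
  by (simp add: L1_space_eq defect_commute)

lemma defect_in_L1: "defect q x \<in> L1_space \<alpha> \<pi> V q"
  by (simp add: L1_space_eq defect_idem)

lemma \<pi>_one_L1: "l \<in> L1_space \<alpha> \<pi> V q \<Longrightarrow> \<pi> (\<alpha> q 1) l = l"
  unfolding L1_space_eq using \<pi>_one_defect[of q l] by simp

lemma Vadj_L1: "l \<in> L1_space \<alpha> \<pi> V q \<Longrightarrow> Vadj q l = 0"
  unfolding L1_space_eq using Vadj_defect[of q l] by simp

text \<open>Applying \<open>V p\<close> to \<open>l = \<pi> (\<alpha> q 1) l\<close> and swapping
  the endomorphisms puts \<open>V p l\<close> in the range of
  \<open>\<pi> (\<alpha> q (\<alpha> p 1))\<close>, on which \<open>\<pi> (\<alpha> q 1)\<close>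
  acts as a unit.\<close>

lemma \<pi>_one_V_L1:
  assumes "l \<in> L1_space \<alpha> \<pi> V q"
  shows "\<pi> (\<alpha> q 1) (V p l) = V p l"
proof -
  have "V p l = \<pi> (\<alpha> q (\<alpha> p 1)) (V p l)"
    using covariant[of p "\<alpha> q 1" l] by (simp add: \<pi>_one_L1[OF assms] \<alpha>_commute[of p q])
  then show ?thesis by (metis \<pi>_\<alpha>_one_idem(2))
qed

lemma V_L1_decomp:
  assumes "l \<in> L1_space \<alpha> \<pi> V q"
  shows "defect q (V p l) = V p l - V q (Vadj q (V p l))"
  using \<pi>_one_V_L1[OF assms] by (simp add: defect_def)

section \<open>The extended star representation\<close>

lemma extended_star_representation:
  "unital_star_representation (UNIV \<times> L1_space \<alpha> \<pi> V q) (extended_pi \<alpha> \<pi> V q)"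
    (is "unital_star_representation ?S ?\<rho>")
proof -
  have L1: "\<And>x y. x \<in> L1_space \<alpha> \<pi> V q \<Longrightarrow> y \<in> L1_space \<alpha> \<pi> V q \<Longrightarrow> x + y \<in> L1_space \<alpha> \<pi> V q"
    "\<And>c x. x \<in> L1_space \<alpha> \<pi> V q \<Longrightarrow> c *\<^sub>C x \<in> L1_space \<alpha> \<pi> V q"
    using closed_csubspace_L1[of q] by (auto simp: closed_csubspace_def)
  have "\<exists>K. \<forall>z\<in>?S. norm (?\<rho> a z) \<le> K * norm z" for a
  proof -
    obtain K M where K: "\<And>x. norm (\<pi> a x) \<le> K * norm x" and M: "\<And>x. norm (\<pi> (\<alpha> q a) x) \<le> M * norm x"
      using \<pi>_bounded[of a] \<pi>_bounded[of "\<alpha> q a"] by (auto simp: bounded_operator_on_def)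
    \<comment> \<open>The constants \<open>K\<close> and \<open>M\<close> come without a sign;
      absolute values make the products monotone.\<close>
    have "norm (?\<rho> a (h, l)) \<le> (\<bar>K\<bar> + \<bar>M\<bar>) * norm (h, l)" if "l \<in> L1_space \<alpha> \<pi> V q" for h l
    proof -
      have "norm (?\<rho> a (h, l)) \<le> norm (\<pi> a h) + norm (\<pi> (\<alpha> q a) l)"
        by (simp add: extended_pi_apply that norm_Pair_le)
      also have "\<dots> \<le> K * norm h + M * norm l" by (intro add_mono K M)
      also have "\<dots> \<le> \<bar>K\<bar> * norm (h, l) + \<bar>M\<bar> * norm (h, l)"
        using norm_fst_le[of h l] norm_snd_le[of l h] by (intro add_mono mult_mono) auto
      finally show ?thesis by (simp add: algebra_simps)
    qed
    then show ?thesis by blast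
  qed
  then have "bounded_operator_on ?S (?\<rho> a)" for a
    unfolding bounded_operator_on_def
    by (auto simp: extended_pi_apply L1 scaleC_prod_def \<pi>_add \<pi>_scaleC \<pi>_L1)
  \<comment> \<open>The adjoint of the block diagonal operator is found by checking the candidate
    \<open>?\<rho> (star a) z\<close> entry by entry.\<close>
  moreover have "?\<rho> (star a) z = adjoint_on ?S (?\<rho> a) z" if "z \<in> ?S" for a z
    using that
    by (intro adjoint_on_eqI[OF closed_csubspace_Times_L1, symmetric])
      (auto simp: extended_pi_apply cinner_prod_def \<pi>_adjoint \<pi>_L1
        \<pi>_L1[where a = "star a", unfolded \<alpha>_star] \<alpha>_star)
  \<comment> \<open>Although \<open>\<alpha> q\<close> may fail to be unital, the second block is:
    \<open>\<pi> (\<alpha> q 1)\<close> is the identity on the subspace.\<close>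
  ultimately show ?thesis
    unfolding unital_star_representation_def
    by (auto simp: extended_pi_apply L1 scaleC_prod_def \<pi>_L1 \<alpha>_add \<alpha>_scaleC \<alpha>_mult
        \<pi>_plus \<pi>_scale \<pi>_mult \<pi>_one \<pi>_one_L1)
qed

section \<open>The extended isometries and their covariance\<close>

lemma norm_extended_V:
  assumes l: "l \<in> L1_space \<alpha> \<pi> V q"
  shows "norm (extended_V \<alpha> \<pi> V q p (h, l)) = norm (h, l)"
proof -
  let ?x = "V p l"
  \<comment> \<open>Moving \<open>V q\<close> to the left, commuting it with \<open>V p\<close> and
    cancelling \<open>V p\<close> leaves an inner product with \<open>Vadj q l\<close>, which is
    0.\<close>
  have "cinner (V p h) (Vadj q ?x) = cinner h (Vadj q l)"
    by (simp add: V_adjoint[of q, symmetric] V_commute[of q] cinner_V)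
  then have orth: "Re (cinner (V p h) (Vadj q ?x)) = 0"
    using cinner_diff_right[of h 0 0] by (simp add: Vadj_L1[OF l])
  \<comment> \<open>Pythagoras applies to this sum: \<open>Vadj q\<close> kills
    \<open>defect q ?x\<close>, which is therefore orthogonal to the range of
    \<open>V q\<close>.\<close>
  have "?x = defect q ?x + V q (Vadj q ?x)" by (simp add: V_L1_decomp[OF l])
  then have "(norm ?x)\<^sup>2 = (norm (defect q ?x))\<^sup>2 + (norm (Vadj q ?x))\<^sup>2"
    using power2_norm_add[of "defect q ?x" "V q (Vadj q ?x)"] cinner_diff_left[of 0 0 "Vadj q ?x"]
    by (simp add: V_norm V_adjoint' Vadj_defect)
  then have "(norm l)\<^sup>2 = (norm (defect q ?x))\<^sup>2 + (norm (Vadj q ?x))\<^sup>2" by (simp add: V_norm)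
  then show ?thesis
    using orth by (simp add: extended_V_apply norm_prod_def power2_norm_add V_norm)
qed

text \<open>The projection removes \<open>V q (Vadj q (V r l))\<close> from the second coordinate.
  After \<open>V p\<close> this loss is \<open>V q (V p (Vadj q (V r l)))\<close>:
  \<open>defect q\<close> annihilates it, and in the first coordinate its image under
  \<open>Vadj q\<close> cancels the extra \<open>V p (Vadj q (V r l))\<close>.\<close>

lemma extended_V_times:
  assumes l: "l \<in> L1_space \<alpha> \<pi> V q"
  shows "extended_V \<alpha> \<pi> V q (p * r) (h, l) = extended_V \<alpha> \<pi> V q p (extended_V \<alpha> \<pi> V q r (h, l))"
proof -
  let ?x = "V r l"
  have "V p (defect q ?x) = V p ?x - V q (V p (Vadj q ?x))"
    by (simp add: V_L1_decomp[OF l] V_diff V_commute[of p q])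
  then show ?thesis
    by (simp add: extended_V_apply V_times V_add Vadj_diff Vadj_V defect_diff defect_V)
qed

lemma extended_isometric_representation:
  "isometric_representation (UNIV \<times> L1_space \<alpha> \<pi> V q) (extended_V \<alpha> \<pi> V q)"
    (is "isometric_representation ?S ?U")
proof -
  have "\<forall>z\<in>?S. norm (?U p z) \<le> 1 * norm z" for p
    by (auto simp: norm_extended_V)
  then have "bounded_operator_on ?S (?U p)" for p
    unfolding bounded_operator_on_def
    by (intro conjI exI[of _ 1])
      (auto simp: extended_V_apply scaleC_prod_def V_add V_scaleC Vadj_add Vadj_scaleC
        defect_add defect_scaleC defect_in_L1 scaleC_add_right)
  \<comment> \<open>At the identity, \<open>Vadj q l = 0\<close> and \<open>defect q l = l\<close>
    reduce the second column to the inclusion of \<open>l\<close>.\<close>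
  then show ?thesis
    unfolding isometric_representation_def
    by (auto simp: norm_extended_V extended_V_times)
      (simp add: extended_V_apply V_one Vadj_L1 L1_space_eq)
qed

text \<open>Once \<open>\<alpha> p (\<alpha> q a)\<close> is rewritten as
  \<open>\<alpha> q (\<alpha> p a)\<close>, \<open>Vadj_\<pi>\<close> settles the off-diagonal entry
  and \<open>defect_commute\<close> the lower diagonal one.\<close>

lemma extended_covariant:
  assumes l: "l \<in> L1_space \<alpha> \<pi> V q"
  shows "extended_V \<alpha> \<pi> V q p (extended_pi \<alpha> \<pi> V q a (h, l))
    = extended_pi \<alpha> \<pi> V q (\<alpha> p a) (extended_V \<alpha> \<pi> V q p (h, l))"
  using l by (simp add: extended_V_apply extended_pi_apply defect_in_L1 covariant \<pi>_add
      \<alpha>_commute[of p q] Vadj_\<pi> defect_commute)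

lemma extended_representation:
  "isometric_right_covariant_representation (UNIV \<times> L1_space \<alpha> \<pi> V q) \<alpha>
     (extended_pi \<alpha> \<pi> V q) (extended_V \<alpha> \<pi> V q)"
  unfolding isometric_right_covariant_representation_def
  by (auto simp: closed_csubspace_Times_L1 extended_star_representation
      extended_isometric_representation extended_covariant)

end

theorem proposition5p4:
  fixes \<alpha> :: "'p::comm_monoid_mult \<Rightarrow> 'a::unital_cstar_algebra \<Rightarrow> 'a"
    and \<pi> :: "'a \<Rightarrow> 'h::chilbert_space \<Rightarrow> 'h"
    and V :: "'p \<Rightarrow> 'h \<Rightarrow> 'h"
    and q :: 'p
  assumes left_cancellative: "\<forall>p r s :: 'p. p * r = p * s \<longrightarrow> r = s"
    and system: "semigroup_dynamical_system \<alpha>"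
    and injective: "injective_system \<alpha>"
    and aligned: "aligned_projections \<alpha>"
    and hereditary_ranges: "\<forall>p. hereditary (range (\<alpha> p))"
    and rep: "isometric_right_covariant_representation UNIV \<alpha> \<pi> V"
    and q: "V q \<circ> adjoint_on UNIV (V q) \<noteq> \<pi> (\<alpha> q 1)"
  shows "isometric_right_covariant_representation (UNIV \<times> L1_space \<alpha> \<pi> V q) \<alpha>
           (extended_pi \<alpha> \<pi> V q) (extended_V \<alpha> \<pi> V q)
       \<and> (\<forall>p. operator_le (V p \<circ> adjoint_on UNIV (V p)) (\<pi> (\<alpha> p 1)))"
proof -
  interpret covariant_pair \<alpha> \<pi> V by standard (rule system rep)+
  show ?thesis using extended_representation range_projection_le by blast
qed

end
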